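(* Let $\mu\in\mathbb{R}$, $\sigma>0$, $\delta=\mu/\sigma$, and let $1\le r<s<t\le n$. Let $X_{1:n}<\dots<X_{n:n}$ be the order statistics of a sample of size $n$ from the density $\frac1\sigma f\left(\frac{x-\mu}{\sigma}\right)$, and let $\boldsymbol X=(X_{1:n},\dots,X_{r:n})^\top$. Let $\hat X_{s:n}=(\boldsymbol\Gamma^{-1}\boldsymbol\Delta_s)^\top\boldsymbol X$ and $\hat X_{t:n}=(\boldsymbol\Gamma^{-1}\boldsymbol\Delta_t)^\top\boldsymbol X$ be the best linear invariant predictors of $X_{s:n}$ and $X_{t:n}$, where $$\boldsymbol\Gamma=\boldsymbol\Sigma+(\boldsymbol\alpha+\delta\boldsymbol 1)(\boldsymbol\alpha+\delta\boldsymbol 1)^\top,\qquad \boldsymbol\Delta_q=\boldsymbol\omega_q+(\alpha_q+\delta)(\boldsymbol\alpha+\delta\boldsymbol 1)\quad (q\in\{s,t\}).$$ Then they possess complete mean squared predictive error matrix dominance in the class of all linear invariant predictors: for every pair of linear predictors $X^*_{s:n}=\boldsymbol a^\top\boldsymbol X$, $X^*_{t:n}=\boldsymbol b^\top\boldsymbol X$ with $\boldsymbol a,\boldsymbol b\in\mathbb{R}^r$, and all $l,k\in\mathbb{R}$, $$\begin{bmatrix} l & k\end{bmatrix} M(\hat X_{s:n},\hat X_{t:n})\begin{bmatrix} l\\ k\end{bmatrix}\le \begin{bmatrix} l & k\end{bmatrix} M(X^*_{s:n},X^*_{t:n})\begin{bmatrix} l\\ k\end{bmatrix},$$ where for predictors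 $U,V$ of $X_{s:n},X_{t:n}$, $M(U,V)=E[\boldsymbol e\boldsymbol e^\top]$ with $\boldsymbol e=(U-X_{s:n},\,V-X_{t:n})^\top$.
   Context: $f$ is a probability density on $\mathbb{R}$, and the sample consists of $n$ i.i.d. random variables with density $\frac1\sigma f\left(\frac{x-\mu}{\sigma}\right)$ (location-scale family). The standardized order statistics are $Z_{i:n}=(X_{i:n}-\mu)/\sigma$, $1\le i\le n$, assumed to have finite second moments. Notation: $\alpha_i=E[Z_{i:n}]$ for $1\le i\le n$; $\boldsymbol\alpha=(\alpha_1,\dots,\alpha_r)^\top$; $\boldsymbol 1=(1,\dots,1)^\top\in\mathbb{R}^r$; $\boldsymbol\Sigma$ is the $r\times r$ covariance matrix of $(Z_{1:n},\dots,Z_{r:n})^\top$, assumed positive definite; $\boldsymbol\omega_q=(\mathrm{Cov}(Z_{1:n},Z_{q:n}),\dots,\mathrm{Cov}(Z_{r:n},Z_{q:n}))^\top\in\mathbb{R}^r$. The class of linear invariant predictors here consists of all $\boldsymbol c^\top\boldsymbol X$ with $\boldsymbol c\in\mathbb{R}^r$ (for fixed $\mu,\sigma$). *)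

theory Defs
  imports
    "HOL-Probability.Probability"
    "Jordan_Normal_Form.Gauss_Jordan_Elimination"
begin

unbundle no vec_syntax

text \<open>Samples and order statistics are indexed from 1, as in the literature, whereas the entries of
  Jordan_Normal_Form vectors and matrices are indexed from 0; hence the \<open>Suc\<close>s below.\<close>

definition order_stat :: "nat \<Rightarrow> (nat \<Rightarrow> 'a \<Rightarrow> real) \<Rightarrow> nat \<Rightarrow> 'a \<Rightarrow> real" where
  "order_stat n X i \<omega> = sort (map (\<lambda>j. X j \<omega>) [1..<Suc n]) ! (i - 1)"

definition std_order_stat ::
    "nat \<Rightarrow> (nat \<Rightarrow> 'a \<Rightarrow> real) \<Rightarrow> real \<Rightarrow> real \<Rightarrow> nat \<Rightarrow> 'a \<Rightarrow> real" where
  "std_order_stat n X \<mu> \<sigma> i \<omega> = (order_stat n X i \<omega> - \<mu>) / \<sigma>"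

definition prob_density :: "(real \<Rightarrow> real) \<Rightarrow> bool" where
  "prob_density f \<longleftrightarrow> f \<in> borel_measurable borel \<and> (\<forall>x. 0 \<le> f x) \<and>
     (\<integral>\<^sup>+ x. ennreal (f x) \<partial>lborel) = 1"

definition loc_scale_density :: "(real \<Rightarrow> real) \<Rightarrow> real \<Rightarrow> real \<Rightarrow> real \<Rightarrow> real" where
  "loc_scale_density f \<mu> \<sigma> x = 1 / \<sigma> * f ((x - \<mu>) / \<sigma>)"

definition iid_sample ::
    "'a measure \<Rightarrow> nat \<Rightarrow> (nat \<Rightarrow> 'a \<Rightarrow> real) \<Rightarrow> (real \<Rightarrow> real) \<Rightarrow> bool" where
  "iid_sample M n X g \<longleftrightarrow>
     prob_space.indep_vars M (\<lambda>_. borel) X {1..n} \<and>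
     (\<forall>i\<in>{1..n}. distributed M lborel (X i) (\<lambda>x. ennreal (g x)))"

definition covariance :: "'a measure \<Rightarrow> ('a \<Rightarrow> real) \<Rightarrow> ('a \<Rightarrow> real) \<Rightarrow> real" where
  "covariance M U V =
     (LINT \<omega>|M. (U \<omega> - (LINT \<omega>'|M. U \<omega>')) * (V \<omega> - (LINT \<omega>'|M. V \<omega>')))"

definition mean_vec :: "'a measure \<Rightarrow> (nat \<Rightarrow> 'a \<Rightarrow> real) \<Rightarrow> nat \<Rightarrow> real vec" where
  "mean_vec M Z r = vec r (\<lambda>i. LINT \<omega>|M. Z (Suc i) \<omega>)"

definition cov_mat :: "'a measure \<Rightarrow> (nat \<Rightarrow> 'a \<Rightarrow> real) \<Rightarrow> nat \<Rightarrow> real mat" where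
  "cov_mat M Z r = mat r r (\<lambda>(i, j). covariance M (Z (Suc i)) (Z (Suc j)))"

definition cov_vec :: "'a measure \<Rightarrow> (nat \<Rightarrow> 'a \<Rightarrow> real) \<Rightarrow> nat \<Rightarrow> nat \<Rightarrow> real vec" where
  "cov_vec M Z r q = vec r (\<lambda>i. covariance M (Z (Suc i)) (Z q))"

definition pos_def_mat :: "real mat \<Rightarrow> bool" where
  "pos_def_mat A \<longleftrightarrow> square_mat A \<and> transpose_mat A = A \<and>
     (\<forall>v \<in> carrier_vec (dim_row A). v \<noteq> 0\<^sub>v (dim_row A) \<longrightarrow> scalar_prod v (A *\<^sub>v v) > 0)"

definition outer_prod :: "real vec \<Rightarrow> real vec \<Rightarrow> real mat" where
  "outer_prod u v = mat (dim_vec u) (dim_vec v) (\<lambda>(i, j). u $ i * v $ j)"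

definition shifted_mean :: "'a measure \<Rightarrow> (nat \<Rightarrow> 'a \<Rightarrow> real) \<Rightarrow> nat \<Rightarrow> real \<Rightarrow> real vec" where
  "shifted_mean M Z r \<delta> = mean_vec M Z r + \<delta> \<cdot>\<^sub>v vec r (\<lambda>_. 1)"

definition Gamma_mat :: "'a measure \<Rightarrow> (nat \<Rightarrow> 'a \<Rightarrow> real) \<Rightarrow> nat \<Rightarrow> real \<Rightarrow> real mat" where
  "Gamma_mat M Z r \<delta> =
     cov_mat M Z r + outer_prod (shifted_mean M Z r \<delta>) (shifted_mean M Z r \<delta>)"

definition Delta_vec ::
    "'a measure \<Rightarrow> (nat \<Rightarrow> 'a \<Rightarrow> real) \<Rightarrow> nat \<Rightarrow> real \<Rightarrow> nat \<Rightarrow> real vec" where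
  "Delta_vec M Z r \<delta> q =
     cov_vec M Z r q + ((LINT \<omega>|M. Z q \<omega>) + \<delta>) \<cdot>\<^sub>v shifted_mean M Z r \<delta>"

definition linear_pred ::
    "nat \<Rightarrow> (nat \<Rightarrow> 'a \<Rightarrow> real) \<Rightarrow> nat \<Rightarrow> real vec \<Rightarrow> 'a \<Rightarrow> real" where
  "linear_pred n X r c \<omega> = scalar_prod c (vec r (\<lambda>i. order_stat n X (Suc i) \<omega>))"

text \<open>\<open>mat_inverse\<close> is option-valued. If the covariance matrix is positive definite then so is
  \<open>Gamma_mat\<close>, so that \<open>the\<close> is applied to an actual inverse.\<close>

definition blip ::
    "'a measure \<Rightarrow> nat \<Rightarrow> (nat \<Rightarrow> 'a \<Rightarrow> real) \<Rightarrow> nat \<Rightarrow> real \<Rightarrow> real \<Rightarrow> nat \<Rightarrow> 'a \<Rightarrow> real" where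
  "blip M n X r \<mu> \<sigma> q =
     (let Z = std_order_stat n X \<mu> \<sigma>; \<delta> = \<mu> / \<sigma> in
       linear_pred n X r (the (mat_inverse (Gamma_mat M Z r \<delta>)) *\<^sub>v Delta_vec M Z r \<delta> q))"

definition mspe_mat ::
    "'a measure \<Rightarrow> nat \<Rightarrow> (nat \<Rightarrow> 'a \<Rightarrow> real) \<Rightarrow> nat \<Rightarrow> nat \<Rightarrow>
      ('a \<Rightarrow> real) \<Rightarrow> ('a \<Rightarrow> real) \<Rightarrow> real mat" where
  "mspe_mat M n X s t U V =
     (let e = (\<lambda>\<omega>. vec_of_list [U \<omega> - order_stat n X s \<omega>, V \<omega> - order_stat n X t \<omega>])
      in mat 2 2 (\<lambda>(i, j). LINT \<omega>|M. outer_prod (e \<omega>) (e \<omega>) $$ (i, j)))"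

definition quad_form :: "real mat \<Rightarrow> real vec \<Rightarrow> real" where
  "quad_form A v = scalar_prod v (A *\<^sub>v v)"

end

theory Submission
  imports Defs "Jordan_Normal_Form.Determinant"
begin

text \<open>Writing \<open>Y\<^sub>i = X\<^bsub>i:n\<^esub> = \<sigma> (Z\<^bsub>i:n\<^esub> + \<delta>)\<close>, the matrix \<open>\<Gamma>\<close> and the vectors \<open>\<Delta>\<close> are, up to the factor
  \<open>1 / \<sigma>\<^sup>2\<close>, the uncentred second moments of the order statistics. Hence \<open>\<Gamma> c = \<Delta>\<close> are the normal
  equations: the residual \<open>c \<bullet> Y - Y\<^sub>q\<close> is orthogonal in \<open>L\<^sup>2\<close> to \<open>Y\<^sub>1, \<dots>, Y\<^sub>r\<close>. The quadratic form of
  the error matrix at \<open>(l, k)\<close> is the second moment of \<open>l e\<^sub>1 + k e\<^sub>2\<close>, and passing to other linear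
  predictors adds to it a linear combination of \<open>Y\<^sub>1, \<dots>, Y\<^sub>r\<close>, so the claim is Pythagoras.\<close>

text \<open>In a sorted list the elements that are at most \<open>y\<close> form a prefix, so
  whether position \<open>i\<close> lies in it is decided by its length alone. This trades the value
  of an order statistic for a count.\<close>

lemma sorted_nth_le_iff:
  fixes xs :: "'a::linorder list"
  assumes "sorted xs" "i < length xs"
  shows "xs ! i \<le> y \<longleftrightarrow> i < length (filter (\<lambda>x. x \<le> y) xs)"
  using assms
proof (induction xs arbitrary: i)
  case (Cons x xs)
  show ?case
  proof (cases "x \<le> y")
    case True
    then show ?thesis using Cons by (cases i) auto
  next
    case False
    then have "\<forall>z\<in>set (x # xs). \<not> z \<le> y"
      using Cons.prems(1) by auto
    moreover have "(x # xs) ! i \<in> set (x # xs)"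
      using Cons.prems(2) nth_mem by blast
    ultimately show ?thesis
      by (metis filter_False gr_implies_not0 list.size(3))
  qed
qed simp

text \<open>A sublevel set of the \<open>i\<close>-th order statistic is the event that at least
  \<open>i\<close> of the sample values are at most \<open>y\<close>, and such a count is a
  measurable function. Sorting itself never has to be shown measurable.\<close>

lemma borel_measurable_order_stat:
  assumes "\<And>j. j \<in> {1..n} \<Longrightarrow> X j \<in> borel_measurable M" and "i \<in> {1..n}"
  shows "order_stat n X i \<in> borel_measurable M"
proof (subst borel_measurable_iff_le, intro allI)
  fix y
  \<comment> \<open>Stated for an arbitrary list of indices so that it can be proved by induction on
    that list.\<close>
  have cnt: "(\<lambda>\<omega>. length (filter (\<lambda>j. X j \<omega> \<le> y) js)) \<in> measurable M (count_space UNIV)"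
    if "set js \<subseteq> {1..n}" for js
    using that
  proof (induction js)
    case (Cons j js)
    have [measurable]: "X j \<in> borel_measurable M"
        "(\<lambda>\<omega>. length (filter (\<lambda>j. X j \<omega> \<le> y) js)) \<in> measurable M (count_space UNIV)"
      using Cons assms(1) by auto
    have "(\<lambda>\<omega>. length (filter (\<lambda>j. X j \<omega> \<le> y) (j # js)))
        = (\<lambda>\<omega>. if X j \<omega> \<le> y then Suc (length (filter (\<lambda>j. X j \<omega> \<le> y) js))
                 else length (filter (\<lambda>j. X j \<omega> \<le> y) js))"
      by (auto simp: fun_eq_iff)
    then show ?case by simp
  qed simp
  have [measurable]:
    "(\<lambda>\<omega>. length (filter (\<lambda>j. X j \<omega> \<le> y) [1..<Suc n])) \<in> measurable M (count_space UNIV)"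
    by (rule cnt) auto
  \<comment> \<open>Ranks start at 1 and list positions at 0. As \<open>i\<close> is at least 1, the
    strict inequality for \<open>i - 1\<close> says that the count is at least
    \<open>i\<close>.\<close>
  have "order_stat n X i \<omega> \<le> y \<longleftrightarrow> i - 1 < length (filter (\<lambda>j. X j \<omega> \<le> y) [1..<Suc n])" for \<omega>
  proof -
    have "i - 1 < length (sort (map (\<lambda>j. X j \<omega>) [1..<Suc n]))"
      using assms(2) by auto
    from sorted_nth_le_iff[OF _ this, of y] show ?thesis
      by (simp add: order_stat_def filter_sort filter_map o_def del: upt_Suc)
  qed
  then have "{\<omega> \<in> space M. order_stat n X i \<omega> \<le> y}
      = {\<omega> \<in> space M. i - 1 < length (filter (\<lambda>j. X j \<omega> \<le> y) [1..<Suc n])}"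
    by blast
  also have "\<dots> \<in> sets M" by measurable
  finally show "{\<omega> \<in> space M. order_stat n X i \<omega> \<le> y} \<in> sets M" .
qed

text \<open>Integrability of \<open>U\<^sup>2\<close> alone does not make \<open>U\<close> measurable.\<close>

definition square_integrable :: "'a measure \<Rightarrow> ('a \<Rightarrow> real) \<Rightarrow> bool" where
  "square_integrable M U \<longleftrightarrow> U \<in> borel_measurable M \<and> integrable M (\<lambda>\<omega>. (U \<omega>)\<^sup>2)"

text \<open>The product is dominated by the sum of the squares, a crude form of the
  arithmetic-geometric mean inequality.\<close>

lemma integrable_mult_square_integrable:
  assumes "square_integrable M U" "square_integrable M V"
  shows "integrable M (\<lambda>\<omega>. U \<omega> * V \<omega>)"
proof (rule Bochner_Integration.integrable_bound)
  show "integrable M (\<lambda>\<omega>. (U \<omega>)\<^sup>2 + (V \<omega>)\<^sup>2)"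
    using assms by (auto simp: square_integrable_def)
  show "(\<lambda>\<omega>. U \<omega> * V \<omega>) \<in> borel_measurable M"
    using assms by (auto simp: square_integrable_def)
  have "\<bar>u * v\<bar> \<le> u\<^sup>2 + v\<^sup>2" for u v :: real
  proof -
    have "2 * (\<bar>u\<bar> * \<bar>v\<bar>) \<le> u\<^sup>2 + v\<^sup>2"
      using sum_squares_bound[of "\<bar>u\<bar>" "\<bar>v\<bar>"] by simp
    moreover have "0 \<le> \<bar>u\<bar> * \<bar>v\<bar>" by simp
    ultimately show ?thesis unfolding abs_mult by linarith
  qed
  then show "AE \<omega> in M. norm (U \<omega> * V \<omega>) \<le> norm ((U \<omega>)\<^sup>2 + (V \<omega>)\<^sup>2)"
    by simp
qed

lemma square_integrable_add:
  assumes "square_integrable M U" "square_integrable M V"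
  shows "square_integrable M (\<lambda>\<omega>. U \<omega> + V \<omega>)"
  using assms integrable_mult_square_integrable[OF assms]
  by (auto simp: square_integrable_def power2_sum mult.assoc)

lemma square_integrable_cmult:
  "square_integrable M U \<Longrightarrow> square_integrable M (\<lambda>\<omega>. c * U \<omega>)"
  by (auto simp: square_integrable_def power_mult_distrib)

lemma square_integrable_diff:
  assumes "square_integrable M U" "square_integrable M V"
  shows "square_integrable M (\<lambda>\<omega>. U \<omega> - V \<omega>)"
  using square_integrable_add[OF assms(1) square_integrable_cmult[OF assms(2), of "-1"]] by simp

lemma square_integrable_sum:
  assumes "\<And>i. i \<in> I \<Longrightarrow> square_integrable M (U i)"
  shows "square_integrable M (\<lambda>\<omega>. \<Sum>i\<in>I. U i \<omega>)"
  using assms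
\<comment> \<open>A sum over an infinite index set is 0 by convention, so that case is as trivial as
  the empty one.\<close>
proof (induction I rule: infinite_finite_induct)
  case (insert i I)
  then show ?case by (auto intro: square_integrable_add)
qed (auto simp: square_integrable_def)

lemma (in prob_space) covariance_eq:
  assumes "square_integrable M U" "square_integrable M V"
  shows "covariance M U V = expectation (\<lambda>\<omega>. U \<omega> * V \<omega>) - expectation U * expectation V"
proof -
  have [simp]: "integrable M U" "integrable M V"
    using assms by (auto simp: square_integrable_def intro: square_integrable_imp_integrable)
  note [simp] = integrable_mult_square_integrable[OF assms]
  have "covariance M U V = expectation (\<lambda>\<omega>. U \<omega> * V \<omega> - expectation V * U \<omega>
      - expectation U * V \<omega> + expectation U * expectation V)"
    unfolding covariance_def by (rule Bochner_Integration.integral_cong) (auto simp: algebra_simps)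
  then show ?thesis by (simp add: prob_space)
qed

text \<open>With \<open>c\<close> equal to \<delta> the right-hand side is exactly the shape of the
  entries of \<open>Gamma_mat\<close> and \<open>Delta_vec\<close>; this is what identifies them as
  uncentred moments.\<close>

lemma (in prob_space) expectation_mult_shift:
  assumes "square_integrable M U" "square_integrable M V"
  shows "expectation (\<lambda>\<omega>. (U \<omega> + c) * (V \<omega> + c))
    = covariance M U V + (expectation U + c) * (expectation V + c)"
proof -
  have [simp]: "integrable M U" "integrable M V"
    using assms by (auto simp: square_integrable_def intro: square_integrable_imp_integrable)
  note [simp] = integrable_mult_square_integrable[OF assms]
  have "expectation (\<lambda>\<omega>. (U \<omega> + c) * (V \<omega> + c))
      = expectation (\<lambda>\<omega>. U \<omega> * V \<omega> + c * U \<omega> + c * V \<omega> + c * c)"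
    by (rule Bochner_Integration.integral_cong) (auto simp: algebra_simps)
  then show ?thesis
    by (simp add: prob_space covariance_eq[OF assms] algebra_simps)
qed

text \<open>The rank-one term contributes the square of \<open>scalar_prod u v\<close> to the
  quadratic form, which cannot be negative.\<close>

lemma pos_def_mat_add_outer_prod:
  assumes A: "A \<in> carrier_mat r r" "pos_def_mat A" and u: "u \<in> carrier_vec r"
  shows "pos_def_mat (A + outer_prod u u)"
proof -
  have O: "outer_prod u u \<in> carrier_mat r r"
    using u by (auto simp: outer_prod_def)
  have "scalar_prod v ((A + outer_prod u u) *\<^sub>v v) > 0"
    if v: "v \<in> carrier_vec r" "v \<noteq> 0\<^sub>v r" for v
  proof -
    have "outer_prod u u *\<^sub>v v = scalar_prod u v \<cdot>\<^sub>v u"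
      using u v by (intro eq_vecI)
        (auto simp: outer_prod_def scalar_prod_def sum_distrib_left sum_distrib_right ac_simps)
    moreover have "scalar_prod v u = scalar_prod u v"
      using u v by (intro comm_scalar_prod) auto
    ultimately have "scalar_prod v ((A + outer_prod u u) *\<^sub>v v)
        = scalar_prod v (A *\<^sub>v v) + scalar_prod u v * scalar_prod u v"
      using A(1) O u v
      by (simp add: add_mult_distrib_mat_vec[OF A(1) O v(1)] scalar_prod_add_distrib[where n = r])
    moreover have "scalar_prod v (A *\<^sub>v v) > 0"
      using A v by (auto simp: pos_def_mat_def)
    ultimately show ?thesis by (simp add: add_pos_nonneg)
  qed
  moreover have "transpose_mat (A + outer_prod u u) = A + outer_prod u u"
  proof -
    have "transpose_mat (outer_prod u u) = outer_prod u u"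
      by (intro eq_matI) (auto simp: outer_prod_def ac_simps)
    moreover have "transpose_mat A = A" using A(2) by (simp add: pos_def_mat_def)
    ultimately show ?thesis by (simp add: transpose_add[OF A(1) O])
  qed
  ultimately show ?thesis
    using A(1) O by (auto simp: pos_def_mat_def)
qed

text \<open>A nonzero kernel vector would make the quadratic form vanish, so the determinant is
  nonzero and \<open>mat_inverse\<close> returns an actual inverse.\<close>

lemma pos_def_mat_inverse_solves:
  assumes A: "A \<in> carrier_mat r r" "pos_def_mat A" and d: "d \<in> carrier_vec r"
  shows "the (mat_inverse A) *\<^sub>v d \<in> carrier_vec r"
    and "A *\<^sub>v (the (mat_inverse A) *\<^sub>v d) = d"
proof -
  have "det A \<noteq> 0"
  proof
    assume "det A = 0"
    then obtain v where v: "v \<in> carrier_vec r" "v \<noteq> 0\<^sub>v r" "A *\<^sub>v v = 0\<^sub>v r"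
      using det_0_iff_vec_prod_zero[OF A(1)] by blast
    then have "scalar_prod v (A *\<^sub>v v) > 0"
      using A by (auto simp: pos_def_mat_def)
    with v show False by simp
  qed
  \<comment> \<open>The last argument of \<open>ring_mat\<close> is a dummy that does not affect the
    units; it only has to agree with the instance of \<open>mat_inverse(1)\<close> used
    next.\<close>
  then have "A \<in> Units (ring_mat TYPE(real) r (undefined :: nat))"
    by (rule det_non_zero_imp_unit[OF A(1)])
  then obtain B where B: "mat_inverse A = Some B"
    using mat_inverse(1)[OF A(1), of "undefined :: nat"] by (cases "mat_inverse A") auto
  note AB = mat_inverse(2)[OF A(1) B]
  show "the (mat_inverse A) *\<^sub>v d \<in> carrier_vec r"
    using AB B d by auto
  have "A *\<^sub>v (B *\<^sub>v d) = (A * B) *\<^sub>v d"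
    using A(1) AB d by (metis assoc_mult_mat_vec)
  then show "A *\<^sub>v (the (mat_inverse A) *\<^sub>v d) = d"
    using AB B d by auto
qed

text \<open>Reduces the matrix comparison to one between scalar second moments. The matrix entries
  are separate integrals, and square integrability allows them to be recombined into the integral of
  one square.\<close>

lemma quad_form_mspe_mat:
  assumes "square_integrable M U" "square_integrable M V"
    and "square_integrable M (order_stat n X s)" "square_integrable M (order_stat n X t)"
  shows "quad_form (mspe_mat M n X s t U V) (vec_of_list [l, k])
    = (LINT \<omega>|M. (l * (U \<omega> - order_stat n X s \<omega>) + k * (V \<omega> - order_stat n X t \<omega>))\<^sup>2)"
proof -
  define e where "e = (\<lambda>\<omega>. U \<omega> - order_stat n X s \<omega>)"
  define g where "g = (\<lambda>\<omega>. V \<omega> - order_stat n X t \<omega>)"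
  have e: "square_integrable M e" and g: "square_integrable M g"
    unfolding e_def g_def using assms by (auto intro: square_integrable_diff)
  note [simp] = integrable_mult_square_integrable[OF e e] integrable_mult_square_integrable[OF e g]
    integrable_mult_square_integrable[OF g g]
  have "(LINT \<omega>|M. (l * e \<omega> + k * g \<omega>)\<^sup>2)
      = (LINT \<omega>|M. l * l * (e \<omega> * e \<omega>) + 2 * l * k * (e \<omega> * g \<omega>)
          + k * k * (g \<omega> * g \<omega>))"
    by (rule Bochner_Integration.integral_cong) (auto simp: algebra_simps power2_eq_square)
  also have "\<dots> = l * l * (LINT \<omega>|M. e \<omega> * e \<omega>) + 2 * l * k * (LINT \<omega>|M. e \<omega> * g \<omega>)
      + k * k * (LINT \<omega>|M. g \<omega> * g \<omega>)"
    by simp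
  also have "\<dots> = quad_form (mspe_mat M n X s t U V) (vec_of_list [l, k])"
    by (simp add: quad_form_def mspe_mat_def scalar_prod_def outer_prod_def numeral_2_eq_2
        e_def g_def algebra_simps)
  finally show ?thesis by (simp add: e_def g_def)
qed

text \<open>\<open>scalar_prod\<close> sums up to the dimension of its second argument, here
  \<open>r\<close>, so this holds for \<open>c\<close> of any dimension.\<close>

lemma linear_pred_eq_sum:
  "linear_pred n X r c = (\<lambda>\<omega>. \<Sum>i<r. c $ i * order_stat n X (Suc i) \<omega>)"
  by (auto simp: fun_eq_iff linear_pred_def scalar_prod_def atLeast0LessThan)

text \<open>Pythagoras: the cross term vanishes by orthogonality, and the second moment of
  \<open>W\<close> is nonnegative.\<close>

lemma second_moment_le_add_orthogonal:
  assumes "square_integrable M U" "square_integrable M W" "(LINT \<omega>|M. U \<omega> * W \<omega>) = 0"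
  shows "(LINT \<omega>|M. (U \<omega>)\<^sup>2) \<le> (LINT \<omega>|M. (U \<omega> + W \<omega>)\<^sup>2)"
proof -
  note [simp] = integrable_mult_square_integrable[OF assms(1,2)]
  have [simp]: "integrable M (\<lambda>\<omega>. (U \<omega>)\<^sup>2)" "integrable M (\<lambda>\<omega>. (W \<omega>)\<^sup>2)"
    using assms by (auto simp: square_integrable_def)
  have "(LINT \<omega>|M. (U \<omega> + W \<omega>)\<^sup>2) = (LINT \<omega>|M. (U \<omega>)\<^sup>2) + (LINT \<omega>|M. (W \<omega>)\<^sup>2)"
    by (simp add: power2_sum mult.assoc assms(3))
  then show ?thesis by simp
qed

theorem mainTheorem4:
  fixes M :: "'a measure"
    and f :: "real \<Rightarrow> real"
    and \<mu> \<sigma> :: real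
    and n r s t :: nat
    and X :: "nat \<Rightarrow> 'a \<Rightarrow> real"
  assumes "prob_space M"
    and "prob_density f"
    and "\<sigma> > 0"
    and "1 \<le> r" and "r < s" and "s < t" and "t \<le> n"
    and "iid_sample M n X (loc_scale_density f \<mu> \<sigma>)"
    and "\<forall>i\<in>{1..n}. integrable M (\<lambda>\<omega>. (std_order_stat n X \<mu> \<sigma> i \<omega>)\<^sup>2)"
    and "pos_def_mat (cov_mat M (std_order_stat n X \<mu> \<sigma>) r)"
  shows "\<forall>a \<in> carrier_vec r. \<forall>b \<in> carrier_vec r. \<forall>l k :: real.
    quad_form (mspe_mat M n X s t (blip M n X r \<mu> \<sigma> s) (blip M n X r \<mu> \<sigma> t)) (vec_of_list [l, k])
    \<le> quad_form (mspe_mat M n X s t (linear_pred n X r a) (linear_pred n X r b)) (vec_of_list [l, k])"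
proof (intro ballI allI)
  fix a b :: "real vec" and l k :: real
  assume ab: "a \<in> carrier_vec r" "b \<in> carrier_vec r"
  interpret prob_space M by fact
  define Y where "Y = order_stat n X"
  define Z where "Z = std_order_stat n X \<mu> \<sigma>"
  define \<delta> where "\<delta> = \<mu> / \<sigma>"
  have YZ: "Y i \<omega> = \<sigma> * (Z i \<omega> + \<delta>)" for i \<omega>
    using \<open>\<sigma> > 0\<close> by (simp add: Y_def Z_def \<delta>_def std_order_stat_def field_simps)
  have Ym: "Y i \<in> borel_measurable M" if "i \<in> {1..n}" for i
    unfolding Y_def using that assms(8)
    by (intro borel_measurable_order_stat) (auto simp: iid_sample_def distributed_def)
  have Z: "square_integrable M (Z i)" if "i \<in> {1..n}" for i
    using Ym[OF that] assms(9) that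
    by (auto simp: square_integrable_def Z_def Y_def std_order_stat_def[abs_def])
  have Y: "square_integrable M (Y i)" if "i \<in> {1..n}" for i
  proof -
    have "square_integrable M (\<lambda>_. \<delta>)" by (simp add: square_integrable_def)
    from square_integrable_cmult[OF square_integrable_add[OF Z[OF that] this], of \<sigma>]
    show ?thesis by (simp add: YZ[abs_def])
  qed
  have EY: "expectation (\<lambda>\<omega>. Y i \<omega> * Y j \<omega>)
      = \<sigma>\<^sup>2 * (covariance M (Z i) (Z j) + (expectation (Z i) + \<delta>) * (expectation (Z j) + \<delta>))"
    if "i \<in> {1..n}" "j \<in> {1..n}" for i j
  proof -
    have "expectation (\<lambda>\<omega>. Y i \<omega> * Y j \<omega>)
        = expectation (\<lambda>\<omega>. \<sigma>\<^sup>2 * ((Z i \<omega> + \<delta>) * (Z j \<omega> + \<delta>)))"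
      by (rule Bochner_Integration.integral_cong) (auto simp: YZ power2_eq_square)
    then show ?thesis by (simp add: expectation_mult_shift[OF Z[OF that(1)] Z[OF that(2)]])
  qed
  define G where "G = Gamma_mat M Z r \<delta>"
  define D where "D = Delta_vec M Z r \<delta>"
  have G: "G \<in> carrier_mat r r"
    by (auto simp: G_def Gamma_mat_def cov_mat_def outer_prod_def shifted_mean_def mean_vec_def)
  have D: "D q \<in> carrier_vec r" for q
    by (auto simp: D_def Delta_vec_def cov_vec_def shifted_mean_def mean_vec_def)
  have Gpos: "pos_def_mat G"
    unfolding G_def Gamma_mat_def
    using assms(10) by (intro pos_def_mat_add_outer_prod[where r = r])
      (auto simp: Z_def cov_mat_def shifted_mean_def mean_vec_def)
  \<comment> \<open>The chain \<open>r < s < t \<le> n\<close> puts every \<open>Suc i\<close> with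
    \<open>i < r\<close> into the range \<open>{1..n}\<close> where \<open>EY\<close>
    applies.\<close>
  have G_nth: "\<sigma>\<^sup>2 * G $$ (i, j) = expectation (\<lambda>\<omega>. Y (Suc i) \<omega> * Y (Suc j) \<omega>)"
    if "i < r" "j < r" for i j
    using that assms(5-7)
    by (simp add: EY G_def Gamma_mat_def cov_mat_def outer_prod_def shifted_mean_def mean_vec_def)
  have D_nth: "\<sigma>\<^sup>2 * D q $ i = expectation (\<lambda>\<omega>. Y (Suc i) \<omega> * Y q \<omega>)"
    if "i < r" "q \<in> {1..n}" for i q
    using that assms(5-7)
    by (simp add: EY D_def Delta_vec_def cov_vec_def shifted_mean_def mean_vec_def)
  define C where "C q = the (mat_inverse G) *\<^sub>v D q" for q
  \<comment> \<open>These are the normal equations; \<open>C q\<close> is the coefficient vector of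
    the best predictor of \<open>Y q\<close>.\<close>
  have C: "C q \<in> carrier_vec r" "G *\<^sub>v C q = D q" for q
    unfolding C_def using pos_def_mat_inverse_solves[OF G Gpos D] by auto
  define P where "P c \<omega> = (\<Sum>i<r. c $ i * Y (Suc i) \<omega>)" for c \<omega>
  have P: "square_integrable M (P c)" for c
    unfolding P_def[abs_def] using assms(5-7)
    by (intro square_integrable_sum square_integrable_cmult Y) auto
  have lp: "linear_pred n X r c = P c" for c
    by (simp add: linear_pred_eq_sum P_def[abs_def] Y_def)
  have blip: "blip M n X r \<mu> \<sigma> q = P (C q)" for q
    by (simp add: blip_def Let_def lp C_def G_def D_def Z_def \<delta>_def)
  define R where "R q \<omega> = P (C q) \<omega> - Y q \<omega>" for q \<omega>
  have R: "square_integrable M (R q)" if "q \<in> {1..n}" for q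
    unfolding R_def[abs_def] by (intro square_integrable_diff P Y that)
  \<comment> \<open>Row \<open>i\<close> of the normal equations, multiplied by
    \<open>\<sigma>\<^sup>2\<close> and read as a statement about expectations through
    \<open>G_nth\<close> and \<open>D_nth\<close>.\<close>
  have normal: "expectation (\<lambda>\<omega>. R q \<omega> * Y (Suc i) \<omega>) = 0" if q: "q \<in> {1..n}" and i: "i < r" for q i
  proof -
    have int: "integrable M (\<lambda>\<omega>. Y (Suc i) \<omega> * Y j \<omega>)" if "j \<in> {1..n}" for j
      using assms(5-7) i that by (intro integrable_mult_square_integrable Y) auto
    have int_sum: "integrable M (\<lambda>\<omega>. \<Sum>j<r. C q $ j * (Y (Suc i) \<omega> * Y (Suc j) \<omega>))"
      using assms(5-7) by (intro Bochner_Integration.integrable_sum integrable_mult_right int) auto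
    have "expectation (\<lambda>\<omega>. R q \<omega> * Y (Suc i) \<omega>)
        = expectation (\<lambda>\<omega>. (\<Sum>j<r. C q $ j * (Y (Suc i) \<omega> * Y (Suc j) \<omega>)) - Y (Suc i) \<omega> * Y q \<omega>)"
      by (rule Bochner_Integration.integral_cong)
        (auto simp: R_def P_def algebra_simps sum_distrib_left)
    also have "\<dots> = (\<Sum>j<r. C q $ j * expectation (\<lambda>\<omega>. Y (Suc i) \<omega> * Y (Suc j) \<omega>))
        - expectation (\<lambda>\<omega>. Y (Suc i) \<omega> * Y q \<omega>)"
      using assms(5-7)
      by (subst Bochner_Integration.integral_diff[OF int_sum int[OF q]],
          subst Bochner_Integration.integral_sum)
        (auto intro!: integrable_mult_right int)
    also have "\<dots> = \<sigma>\<^sup>2 * ((\<Sum>j<r. G $$ (i, j) * C q $ j) - D q $ i)"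
      using i q by (simp add: right_diff_distrib sum_distrib_left flip: G_nth D_nth) (simp add: ac_simps)
    also have "(\<Sum>j<r. G $$ (i, j) * C q $ j) = (G *\<^sub>v C q) $ i"
      using i G C(1)[of q] by (simp add: scalar_prod_def atLeast0LessThan)
    finally show ?thesis by (simp add: C(2))
  qed
  have orth: "expectation (\<lambda>\<omega>. R q \<omega> * P c \<omega>) = 0" if q: "q \<in> {1..n}" for q c
  proof -
    have "expectation (\<lambda>\<omega>. R q \<omega> * P c \<omega>) = expectation (\<lambda>\<omega>. \<Sum>i<r. c $ i * (R q \<omega> * Y (Suc i) \<omega>))"
      by (rule Bochner_Integration.integral_cong) (auto simp: P_def sum_distrib_left ac_simps)
    also have "\<dots> = (\<Sum>i<r. c $ i * expectation (\<lambda>\<omega>. R q \<omega> * Y (Suc i) \<omega>))"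
      using assms(5-7) q
      by (subst Bochner_Integration.integral_sum)
        (auto intro!: integrable_mult_square_integrable R Y)
    finally show ?thesis using normal[OF q] by simp
  qed
  have st: "s \<in> {1..n}" "t \<in> {1..n}" using assms(4-7) by auto
  define U where "U \<omega> = l * R s \<omega> + k * R t \<omega>" for \<omega>
  \<comment> \<open>\<open>U\<close> is the combined error of the best predictors. The vector
    \<open>c\<close> collects the coefficient differences for both targets, weighted by
    \<open>l\<close> and \<open>k\<close>, so that adding \<open>P c\<close> to \<open>U\<close>
    gives the combined error of the competitors \<open>a\<close> and \<open>b\<close>.\<close>
  define c where "c = vec r (\<lambda>i. l * (a $ i - C s $ i) + k * (b $ i - C t $ i))"
  have U: "square_integrable M U"
    unfolding U_def[abs_def] by (intro square_integrable_add square_integrable_cmult R st)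
  have "expectation (\<lambda>\<omega>. U \<omega> * P c \<omega>)
      = expectation (\<lambda>\<omega>. l * (R s \<omega> * P c \<omega>) + k * (R t \<omega> * P c \<omega>))"
    by (rule Bochner_Integration.integral_cong) (auto simp: U_def algebra_simps)
  also have "\<dots> = 0"
    using integrable_mult_square_integrable[OF R[OF st(1)] P[of c]]
      integrable_mult_square_integrable[OF R[OF st(2)] P[of c]] orth st by simp
  \<comment> \<open>The weights \<open>l\<close> and \<open>k\<close> may have any sign, since
    orthogonality to \<open>P c\<close> passes to every linear combination of the two
    residuals.\<close>
  finally have "expectation (\<lambda>\<omega>. (U \<omega>)\<^sup>2) \<le> expectation (\<lambda>\<omega>. (U \<omega> + P c \<omega>)\<^sup>2)"
    by (rule second_moment_le_add_orthogonal[OF U P])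
  moreover have "U \<omega> + P c \<omega> = l * (P a \<omega> - Y s \<omega>) + k * (P b \<omega> - Y t \<omega>)" for \<omega>
  proof -
    have "P c \<omega> = l * (P a \<omega> - P (C s) \<omega>) + k * (P b \<omega> - P (C t) \<omega>)"
      unfolding P_def c_def
      by (simp add: sum_distrib_left sum.distrib[symmetric] sum_subtractf[symmetric] algebra_simps)
    then show ?thesis by (simp add: U_def R_def algebra_simps)
  qed
  ultimately show "quad_form (mspe_mat M n X s t (blip M n X r \<mu> \<sigma> s) (blip M n X r \<mu> \<sigma> t))
      (vec_of_list [l, k])
    \<le> quad_form (mspe_mat M n X s t (linear_pred n X r a) (linear_pred n X r b)) (vec_of_list [l, k])"
    using quad_form_mspe_mat[OF P P Y[OF st(1), unfolded Y_def] Y[OF st(2), unfolded Y_def]]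
    by (simp add: blip lp U_def R_def Y_def)
qed

end
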